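(* For every integer $n\ge1$ and every $\alpha$: $$(-1)^{n-1}(n-1)!\,\frac{\nu_n(\alpha)}{\alpha}=\sum_{k=1}^n\begin{bmatrix}n\\k\end{bmatrix}\sum_{m_1+\dots+m_k=n-1}\binom{n-1}{m_1,\dots,m_k}(n-m_1)(n-m_1-m_2)\cdots(n-m_1-\dots-m_{k-1})(1-\alpha)^{m_k},$$ $$(-1)^{n-1}n\,\frac{\nu_n(\alpha)}{\alpha}=\sum_{k=1}^n\begin{bmatrix}n\\k\end{bmatrix}\sum_{m_1+\dots+m_{k+1}=n-1}\frac{n}{m_1+1}\cdot\frac{n-m_1}{m_2+1}\cdots\frac{n-m_1-\dots-m_{k-1}}{m_k+1}\binom{m_{k+1}-\alpha}{m_{k+1}}.$$ In particular, $$(-1)^{n-1}n!(n-1)!\,a_n=\sum_{k=1}^n\begin{bmatrix}n\\k\end{bmatrix}\sum_{m_1+\dots+m_k=n-1}\binom{n-1}{m_1,\dots,m_k}(n-m_1)\cdots(n-m_1-\dots-m_{k-1}),$$ $$(-1)^{n-1}n\,n!\,a_n=\sum_{k=1}^n\begin{bmatrix}n\\k\end{bmatrix}\sum_{m_1+\dots+m_{k+1}=n-1}\frac{n}{m_1+1}\cdot\frac{n-m_1}{m_2+1}\cdots\frac{n-m_1-\dots-m_{k-1}}{m_k+1}.$$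
   Context: Let $F(x)=x\exp\bigl(\sum_{j\ge1}\frac{x^j}{j\cdot j!}\bigr)$ (the formal series of $xe^{\mathrm{Ei}(x)-\ln|x|-\gamma}$) and let $F^{inv}$ be its compositional inverse. The polynomials $\nu_n(\alpha)$ are defined by $\sum_{n\ge0}\nu_n(\alpha)x^n/n!=\exp(\alpha F^{inv}(x))$, and $a_n=\nu_n'(0)/n!$ (equivalently $\nu_n(\alpha)/\alpha$ evaluated at $\alpha=0$, divided by $n!$). $\begin{bmatrix}n\\k\end{bmatrix}$ denotes the signed Stirling numbers of the first kind, i.e. the coefficient of $x^k$ in $(x)_n=x(x-1)\cdots(x-n+1)$. All inner sums run over tuples of nonnegative integers with the indicated sum; empty products equal $1$; $\binom{n-1}{m_1,\dots,m_k}$ is the multinomial coefficient. *)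

theory Defs
  imports
    "HOL-Computational_Algebra.Formal_Power_Series"
    "HOL-Computational_Algebra.Polynomial"
    "HOL-Combinatorics.Stirling"
begin

unbundle fps_syntax

text \<open>
  Everything is formal, over an arbitrary field of characteristic 0. The inner series below is the
  expansion of Ei(x) - ln |x| - gamma.
\<close>

definition F_series :: "'a::field_char_0 fps" where
  "F_series = fps_X * (fps_exp 1 oo Abs_fps (\<lambda>j. if j = 0 then 0 else 1 / (of_nat j * fact j)))"

definition F_inv :: "'a::field_char_0 fps" where
  "F_inv = fps_inv F_series"

lemma F_series_nth_0 [simp]: "F_series $ 0 = 0"
  by (simp add: F_series_def)

lemma F_series_nth_1 [simp]: "F_series $ Suc 0 = 1"
  by (simp add: F_series_def)

lemma F_inv_compose: "F_inv oo F_series = fps_X" "F_series oo F_inv = fps_X"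
  by (simp_all add: F_inv_def fps_inv fps_inv_right)

lemma F_inv_nth_0 [simp]: "F_inv $ 0 = 0"
  by (simp add: F_inv_def fps_inv_def)

text \<open>
  The generating function is taken over the polynomial ring in the indeterminate \<open>\<alpha>\<close>, so that the
  \<open>\<nu>\<^sub>n\<close> are honest polynomials. As \<^const>\<open>fps_exp\<close> needs a field of coefficients, the
  exponential series is written out with constant polynomials as coefficients;
  \<open>nu_egf\<close> is the evaluated form.
\<close>

definition nu_gf :: "'a::field_char_0 poly fps" where
  "nu_gf = Abs_fps (\<lambda>k. [:1 / fact k:]) oo (fps_const [:0, 1:] * Abs_fps (\<lambda>m. [:F_inv $ m:]))"

definition nu :: "nat \<Rightarrow> 'a::field_char_0 poly" where
  "nu n = smult (fact n) (nu_gf $ n)"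

lemma poly_fps_power_nth:
  "poly ((h ^ i) $ n) x = (Abs_fps (\<lambda>m. poly (h $ m) x) ^ i) $ n"
  for h :: "'a::field_char_0 poly fps"
proof (induction i arbitrary: n)
  case 0
  then show ?case by simp
next
  case (Suc i)
  then show ?case by (simp add: fps_mult_nth poly_sum)
qed

lemma nu_egf:
  fixes \<alpha> :: "'a::field_char_0"
  shows "Abs_fps (\<lambda>n. poly (nu n) \<alpha> / fact n) = fps_exp 1 oo (fps_const \<alpha> * F_inv)"
proof (rule fps_ext)
  fix n
  have *: "Abs_fps (\<lambda>m. poly ((fps_const [:0, 1:] * Abs_fps (\<lambda>m. [:F_inv $ m:])) $ m) \<alpha>) =
      fps_const \<alpha> * F_inv"
    by (rule fps_ext) simp
  show "Abs_fps (\<lambda>n. poly (nu n) \<alpha> / fact n) $ n =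
      (fps_exp 1 oo (fps_const \<alpha> * F_inv)) $ n"
    unfolding fps_compose_nth nu_def nu_gf_def fps_nth_Abs_fps poly_smult poly_sum poly_mult
      poly_fps_power_nth *
    by simp
qed

text \<open>
  The polynomial \<open>\<nu>\<^sub>n(\<alpha>)/\<alpha>\<close>; the division is exact for \<open>n \<ge> 1\<close>, and evaluation at
  \<open>\<alpha> = 0\<close> is meaningful.
\<close>

definition nu_quot :: "nat \<Rightarrow> 'a::field_char_0 poly" where
  "nu_quot n = nu n div [:0, 1:]"

lemma nu_quot_exact:
  assumes "n \<ge> 1"
  shows "[:0, 1:] * nu_quot n = (nu n :: 'a::field_char_0 poly)"
proof -
  have "poly (nu n :: 'a poly) 0 / fact n = (fps_exp 1 oo (fps_const 0 * F_inv)) $ n"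
    using arg_cong [OF nu_egf [of "0::'a"], of "\<lambda>f. f $ n"] unfolding fps_nth_Abs_fps .
  also have "\<dots> = 0"
    using assms by simp
  finally have "poly (nu n :: 'a poly) 0 = 0"
    by simp
  then have "[:0, 1:] dvd (nu n :: 'a poly)"
    by (simp add: poly_eq_0_iff_dvd)
  then show ?thesis
    unfolding nu_quot_def by (rule dvd_mult_div_cancel)
qed

lemma poly_nu_quot:
  assumes "n \<ge> 1" "\<alpha> \<noteq> 0"
  shows "poly (nu_quot n) \<alpha> = poly (nu n) \<alpha> / (\<alpha> :: 'a::field_char_0)"
  using assms(2) by (subst nu_quot_exact [OF assms(1), symmetric]) simp

definition a_coeff :: "nat \<Rightarrow> 'a::field_char_0" where
  "a_coeff n = poly (pderiv (nu n)) 0 / fact n"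

lemma a_coeff_altdef:
  assumes "n \<ge> 1"
  shows "a_coeff n = poly (nu_quot n) 0 / (fact n :: 'a::field_char_0)"
  unfolding a_coeff_def
  by (subst nu_quot_exact [OF assms, symmetric]) (simp add: pderiv_mult pderiv_pCons)

definition falling_poly :: "nat \<Rightarrow> int poly" where
  "falling_poly n = (\<Prod>i<n. [:- int i, 1:])"

text \<open>Signed Stirling numbers of the first kind; the library's \<^const>\<open>stirling\<close> is unsigned.\<close>

definition stirling1 :: "nat \<Rightarrow> nat \<Rightarrow> int" where
  "stirling1 n k = coeff (falling_poly n) k"

lemma stirling1_altdef: "stirling1 n k = (-1) ^ (n + k) * int (stirling n k)"
proof (induction n k rule: stirling.induct)
  case 1
  then show ?case by (simp add: stirling1_def falling_poly_def)
next
  case (2 k)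
  then show ?case by (simp add: stirling1_def falling_poly_def)
next
  case (3 n)
  have "coeff (falling_poly (Suc n)) 0 = 0"
    unfolding poly_0_coeff_0 [symmetric] falling_poly_def by (auto simp: poly_prod)
  then show ?case by (simp add: stirling1_def)
next
  case (4 n k)
  have "falling_poly (Suc n) = pCons 0 (falling_poly n) - smult (int n) (falling_poly n)"
    by (simp add: falling_poly_def mult.commute)
  then have "stirling1 (Suc n) (Suc k) = stirling1 n k - int n * stirling1 n (Suc k)"
    by (simp add: stirling1_def)
  with 4 show ?case by (simp add: algebra_simps)
qed

text \<open>A tuple \<open>(m\<^sub>1, \<dots>, m\<^sub>k)\<close> is a list \<open>ms\<close>, with \<open>m\<^sub>i = ms ! (i - 1)\<close>.\<close>

definition tuples :: "nat \<Rightarrow> nat \<Rightarrow> nat list set" where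
  "tuples k s = {ms. length ms = k \<and> sum_list ms = s}"

lemma finite_tuples: "finite (tuples k s)"
proof (rule finite_subset)
  show "tuples k s \<subseteq> {ms. set ms \<subseteq> {..s} \<and> length ms = k}"
    by (auto simp: tuples_def intro: member_le_sum_list)
qed (simp add: finite_lists_length_eq)

definition multinom :: "nat \<Rightarrow> nat list \<Rightarrow> 'a::field_char_0" where
  "multinom s ms = fact s / (\<Prod>m\<leftarrow>ms. fact m)"

text \<open>
  \<open>n - m\<^sub>1 - \<dots> - m\<^sub>i\<close>; the subtraction does not truncate for tuples with sum \<open>n - 1\<close>.
\<close>

definition remain :: "nat \<Rightarrow> nat list \<Rightarrow> nat \<Rightarrow> nat" where
  "remain n ms i = n - sum_list (take i ms)"

end

theory Submission
  imports Defs
begin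

text \<open>
  Write \<open>G\<close> for the inverse series. From \<open>x F' = F e\<^sup>x\<close> one gets \<open>x G' = G e\<^bsup>-G\<^esup>\<close>, so that
  \<open>\<Sum> n (\<nu>\<^sub>n / \<alpha>) x\<^sup>n / n! = x G' e\<^bsup>\<alpha>G\<^esup> = G e\<^bsup>(\<alpha>-1)G\<^esup>\<close>. The Stirling numbers enter through the falling
  factorial \<open>x\<^sup>n D\<^sup>n\<close> of \<open>x D\<close>, which annihilates all powers of \<open>x\<close> below the \<open>n\<close>-th. The
  substitution \<open>x = F(c(s))\<close> turns \<open>G\<close> into \<open>c\<close> and \<open>x D\<close> into \<open>V D\<close> with \<open>V c' = c e\<^bsup>-c\<^esup>\<close>, and
  iterating \<open>V D\<close> produces the sums over tuples. The choice \<open>c = -s\<close>, \<open>V = s e\<^sup>s\<close> gives the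
  multinomial formula; \<open>c = ln (1 - s)\<close>, \<open>V = -c\<close> gives the binomial one.
\<close>

section \<open>Stirling numbers and falling factorials\<close>

text \<open>Evaluation of \<open>falling_poly n\<close> at \<open>m\<close>. Starting at
  \<open>k = 1\<close> loses nothing, because 0 is a root of the polynomial once
  \<open>n \<ge> 1\<close>.\<close>

lemma sum_stirling1_power:
  "(\<Sum>k=1..n. of_int (stirling1 n k) * of_nat m ^ k) = (\<Prod>i<n. of_nat m - of_nat i :: 'a::field_char_0)"
  if "n \<ge> 1"
proof -
  have deg: "degree (falling_poly n) \<le> n"
    using degree_prod_sum_le [of "{..<n}" "\<lambda>i. [:- int i, 1:]"]
    by (simp add: falling_poly_def o_def)
  have "coeff (falling_poly n) 0 = 0"
    unfolding poly_0_coeff_0 [symmetric] falling_poly_def using that by (auto simp: poly_prod)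
  then have 0: "stirling1 n 0 = 0"
    by (simp add: stirling1_def)
  have "(\<Sum>k=1..n. stirling1 n k * int m ^ k) = (\<Sum>k\<le>n. stirling1 n k * int m ^ k)"
    using 0 by (intro sum.mono_neutral_left) (auto simp: not_le)
  also have "\<dots> = poly (falling_poly n) (int m)"
    unfolding poly_altdef stirling1_def using deg
    by (intro sum.mono_neutral_right) (auto simp: coeff_eq_0)
  also have "\<dots> = (\<Prod>i<n. int m - int i)"
    by (simp add: falling_poly_def poly_prod)
  finally have "of_int (\<Sum>k=1..n. stirling1 n k * int m ^ k) = (of_int (\<Prod>i<n. int m - int i) :: 'a)"
    by simp
  then show ?thesis
    by simp
qed

lemma prod_diff_of_nat:
  "(\<Prod>i<n. of_nat n - of_nat i) = (fact n :: 'a::field_char_0)"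
proof -
  have "(\<Prod>i<n. of_nat n - of_nat i) = (\<Prod>i<n. of_nat (n - i) :: 'a)"
    by (intro prod.cong) (auto simp: of_nat_diff)
  also have "\<dots> = of_nat (\<Prod>i<n. n - i)"
    by simp
  also have "(\<Prod>i<n. n - i) = \<Prod>{1..n}"
    by (rule prod.reindex_bij_witness [of _ "\<lambda>i. n - i" "\<lambda>i. n - i"]) auto
  finally show ?thesis
    by (simp add: fact_prod)
qed

section \<open>Differential equations of the series and its inverse\<close>

lemma fps_exp_compose_add:
  fixes c :: "'a::field_char_0 fps"
  assumes "c $ 0 = 0"
  shows "(fps_exp a oo c) * (fps_exp b oo c) = fps_exp (a + b) oo c"
  using assms by (simp add: fps_exp_add_mult fps_compose_mult_distrib)

text \<open>Logarithmic derivative: with \<open>F = x e^E\<close> one has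
  \<open>x F' / F = 1 + x E'\<close>, and \<open>x E' = e^x - 1\<close> because \<open>x D\<close>
  cancels the \<open>1 / j\<close> in the coefficients of \<open>E\<close>.\<close>

lemma fps_X_mult_deriv_F_series:
  "fps_X * fps_deriv F_series = F_series * fps_exp (1 :: 'a::field_char_0)"
proof -
  define E :: "'a fps" where "E = Abs_fps (\<lambda>j. if j = 0 then 0 else 1 / (of_nat j * fact j))"
  have "fps_X * fps_deriv E = fps_exp 1 - 1"
    by (rule fps_ext) (auto simp: E_def fps_mult_nth_1 field_simps split: nat.split)
  moreover have "fps_deriv F_series = (fps_exp 1 oo E) * (1 + fps_X * fps_deriv E)"
    unfolding F_series_def E_def [symmetric]
    by (simp add: fps_compose_deriv E_def algebra_simps)
  ultimately show ?thesis
    by (simp add: F_series_def E_def)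
qed

text \<open>Substituting \<open>G\<close> into \<open>x F' = F e^x\<close> gives
  \<open>G F'(G) = x e^G\<close>, and the chain rule for \<open>F(G) = x\<close> gives
  \<open>F'(G) G' = 1\<close>.\<close>

lemma fps_X_mult_deriv_F_inv:
  "fps_X * fps_deriv F_inv = F_inv * (fps_exp (-1 :: 'a::field_char_0) oo F_inv)"
proof -
  let ?G = "F_inv :: 'a fps"
  have "(fps_X * fps_deriv F_series) oo ?G = (F_series * fps_exp 1) oo ?G"
    by (simp add: fps_X_mult_deriv_F_series)
  then have 1: "?G * (fps_deriv F_series oo ?G) = fps_X * (fps_exp 1 oo ?G)"
    by (simp add: fps_compose_mult_distrib F_inv_compose)
  have 2: "(fps_deriv F_series oo ?G) * fps_deriv ?G = 1"
    using fps_compose_deriv [of ?G F_series] by (simp add: F_inv_compose)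
  have 3: "(fps_exp 1 oo ?G) * (fps_exp (-1) oo ?G) = 1"
    by (simp add: fps_exp_compose_add)
  \<comment> \<open>Inserting \<open>e^G e^(-G) = 1\<close> creates the factor \<open>x e^G\<close>,
    which the first relation rewrites; no series has to be inverted.\<close>
  have "fps_X * fps_deriv ?G = fps_X * ((fps_exp 1 oo ?G) * (fps_exp (-1) oo ?G)) * fps_deriv ?G"
    by (simp only: 3) simp
  also have "\<dots> = (fps_X * (fps_exp 1 oo ?G)) * (fps_exp (-1) oo ?G) * fps_deriv ?G"
    by (simp only: ac_simps)
  also have "\<dots> = ?G * (fps_exp (-1) oo ?G) * ((fps_deriv F_series oo ?G) * fps_deriv ?G)"
    by (simp only: 1 [symmetric] ac_simps)
  also have "\<dots> = ?G * (fps_exp (-1) oo ?G)"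
    by (simp only: 2) simp
  finally show ?thesis .
qed

section \<open>Coefficient formulas for \<open>nu_quot\<close>\<close>

text \<open>As \<open>g\<close> has no constant term, \<open>g ^ i\<close> starts in degree
  \<open>i\<close>, so all inner sums may run to the common bound \<open>n\<close> and be swapped
  with the convolution.\<close>

lemma fps_mult_compose_nth:
  fixes A :: "'a::comm_ring_1 fps"
  assumes "g $ 0 = 0"
  shows "(A * (f oo g)) $ n = (\<Sum>i\<le>n. f $ i * (A * g ^ i) $ n)"
proof -
  have "(f oo g) $ (n - j) = (\<Sum>i\<le>n. f $ i * (g ^ i) $ (n - j))" for j
    unfolding fps_compose_nth using assms
    by (intro sum.mono_neutral_left) (auto simp: startsby_zero_power_prefix)
  then have "(A * (f oo g)) $ n = (\<Sum>j=0..n. \<Sum>i\<le>n. f $ i * (A $ j * (g ^ i) $ (n - j)))"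
    by (simp add: fps_mult_nth sum_distrib_left ac_simps)
  also have "\<dots> = (\<Sum>i\<le>n. f $ i * (A * g ^ i) $ n)"
    by (subst sum.swap) (simp add: fps_mult_nth sum_distrib_left)
  finally show ?thesis .
qed

text \<open>Expanding \<open>exp(\<alpha> G)\<close> in powers of \<alpha> exhibits the factor
  \<alpha>. An equality of polynomials also gives the value at \<open>\<alpha> = 0\<close> that
  \<open>a_coeff\<close> needs.\<close>

lemma nu_quot_eq_sum_monom:
  assumes "n \<ge> 1"
  shows "nu_quot n =
    (\<Sum>i\<le>n. monom (fact n / fact (Suc i) * (F_inv ^ Suc i) $ n) i :: 'a::field_char_0 poly)"
    (is "_ = ?q")
proof -
  have "poly (nu n) x = poly ([:0, 1:] * ?q) x" for x :: 'a
  proof -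
    have "poly (nu n) x / fact n = (fps_exp 1 oo (fps_const x * F_inv)) $ n"
      using arg_cong [OF nu_egf [of x], of "\<lambda>f. f $ n"] unfolding fps_nth_Abs_fps .
    also have "\<dots> = (\<Sum>i\<le>n. x ^ i / fact i * (F_inv ^ i) $ n)"
      by (simp add: fps_compose_nth atLeast0AtMost power_mult_distrib fps_const_power)
    \<comment> \<open>The added term is zero because \<open>F_inv ^ Suc n\<close> has order above
      \<open>n\<close>. The index shift that follows drops the term \<open>i = 0\<close>, zero for
      \<open>n \<ge> 1\<close>, and restores the range.\<close>
    also have "\<dots> = (\<Sum>i\<le>Suc n. x ^ i / fact i * (F_inv ^ i) $ n)"
      by (simp add: startsby_zero_power_prefix del: power_Suc fact_Suc)
    also have "\<dots> = (\<Sum>i\<le>n. x ^ Suc i / fact (Suc i) * (F_inv ^ Suc i) $ n)"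
      using assms by (subst sum.atMost_Suc_shift) (simp del: power_Suc fact_Suc)
    finally show ?thesis
      by (simp add: poly_sum poly_monom sum_distrib_left field_simps del: fact_Suc)
  qed
  then have "poly (nu n) = poly ([:0, 1:] * ?q)"
    by (rule ext)
  then have "nu n = [:0, 1:] * ?q"
    by (simp only: poly_eq_poly_eq_iff)
  then have "[:0, 1:] * nu_quot n = [:0, 1:] * ?q"
    by (simp only: nu_quot_exact [OF assms])
  then show ?thesis
    by (subst (asm) mult_cancel_left) simp
qed

text \<open>Applying \<open>x D\<close> to each power of \<open>G\<close> rather than to
  \<open>exp(\<alpha> G)\<close> avoids dividing by \<alpha>, so \<open>\<alpha> = 0\<close> is
  covered.\<close>

lemma poly_nu_quot_eq_nth:
  assumes "n \<ge> 1"
  shows "of_nat n * poly (nu_quot n) \<alpha> / fact n =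
    (F_inv * (fps_exp (\<alpha> - 1 :: 'a::field_char_0) oo F_inv)) $ n"
proof -
  let ?G = "F_inv :: 'a fps"
  have nth: "of_nat n * (?G ^ Suc i) $ n = of_nat (Suc i) * (fps_X * fps_deriv ?G * ?G ^ i) $ n" for i
  proof -
    have "of_nat n * (?G ^ Suc i) $ n = (fps_X * fps_deriv (?G ^ Suc i)) $ n"
      using assms by (cases n) (simp_all del: power_Suc)
    also have "fps_X * fps_deriv (?G ^ Suc i) =
        fps_const (of_nat (Suc i)) * (fps_X * fps_deriv ?G * ?G ^ i)"
      by (subst fps_deriv_power) (simp only: diff_Suc_1 ac_simps)
    finally show ?thesis
      by (simp only: fps_mult_left_const_nth)
  qed
  have "of_nat n * poly (nu_quot n) \<alpha> / fact n =
      (\<Sum>i\<le>n. \<alpha> ^ i / fact (Suc i) * (of_nat n * (?G ^ Suc i) $ n))"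
    by (simp add: nu_quot_eq_sum_monom [OF assms] poly_sum poly_monom sum_distrib_left
        sum_divide_distrib field_simps del: fact_Suc power_Suc)
  also have "\<dots> = (\<Sum>i\<le>n. fps_exp \<alpha> $ i * (fps_X * fps_deriv ?G * ?G ^ i) $ n)"
    unfolding nth by (intro sum.cong refl) (simp add: field_simps del: of_nat_Suc)
  also have "\<dots> = (fps_X * fps_deriv ?G * (fps_exp \<alpha> oo ?G)) $ n"
    by (subst fps_mult_compose_nth) simp_all
  also have "fps_X * fps_deriv ?G * (fps_exp \<alpha> oo ?G) =
      ?G * ((fps_exp (-1) oo ?G) * (fps_exp \<alpha> oo ?G))"
    by (simp only: fps_X_mult_deriv_F_inv mult.assoc)
  finally show ?thesis
    by (simp add: fps_exp_compose_add)
qed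

section \<open>The Stirling sum after a substitution\<close>

text \<open>With \<open>X = F(c)\<close>, the operator \<open>V D\<close> multiplies
  \<open>X ^ i\<close> by \<open>i\<close>, so the Stirling sum weights \<open>X ^ i\<close> by a
  falling factorial divided by \<open>i\<close>. This kills \<open>i < n\<close>, while
  \<open>X ^ i\<close> has no term of degree \<open>n\<close> for \<open>i > n\<close>; only
  \<open>i = n\<close> is left.\<close>

lemma sum_stirling1_substituted_XD:
  fixes c V :: "'a::field_char_0 fps"
  assumes "n \<ge> 1" and c0: "c $ 0 = 0"
    and cV: "V * fps_deriv c = c * (fps_exp (-1) oo c)"
  shows "(\<Sum>k=1..n. of_int (stirling1 n k) *
      ((\<lambda>f. V * fps_deriv f) ^^ (k - 1)) (c * (fps_exp (\<alpha> - 1) oo c)) $ n) =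
    poly (nu_quot n) \<alpha> * (c $ 1) ^ n"
proof -
  define X where "X = F_series oo c"
  define W :: "'a fps" where "W = F_inv * (fps_exp (\<alpha> - 1) oo F_inv)"
  have X0: "X $ 0 = 0"
    by (simp add: X_def)
  have X1: "X $ Suc 0 = c $ Suc 0"
    by (simp add: X_def fps_compose_nth)
  have W0: "W $ 0 = 0"
    by (simp add: W_def)
  have GX: "F_inv oo X = c"
    using c0 by (simp add: X_def fps_compose_assoc F_inv_compose)
  have WX: "W oo X = c * (fps_exp (\<alpha> - 1) oo c)"
    using X0 GX by (simp add: W_def fps_compose_mult_distrib flip: fps_compose_assoc)
  have "c * (fps_deriv F_series oo c) = X * (fps_exp 1 oo c)"
    using arg_cong [OF fps_X_mult_deriv_F_series, of "\<lambda>f. f oo c"] c0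
    by (simp add: fps_compose_mult_distrib X_def)
  moreover have "V * fps_deriv X = (fps_deriv F_series oo c) * (V * fps_deriv c)"
    using c0 by (simp add: X_def fps_compose_deriv ac_simps)
  ultimately have "V * fps_deriv X = X * ((fps_exp 1 oo c) * (fps_exp (-1) oo c))"
    by (simp only: cV flip: mult.assoc) (simp only: mult.commute)
  then have VX: "V * fps_deriv X = X"
    using c0 by (simp add: fps_exp_compose_add)
  \<comment> \<open>Since \<open>V X' = X\<close>, composition with \<open>X\<close> intertwines
    \<open>x D\<close> and \<open>V D\<close>.\<close>
  have step: "V * fps_deriv (P oo X) = fps_XD P oo X" for P
  proof -
    have "V * fps_deriv (P oo X) = (fps_deriv P oo X) * (V * fps_deriv X)"
      using X0 by (simp add: fps_compose_deriv ac_simps)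
    then show ?thesis
      using X0 by (simp add: VX fps_XD_def fps_compose_mult_distrib)
  qed
  have iter: "((\<lambda>f. V * fps_deriv f) ^^ j) (W oo X) = (fps_XD ^^ j) W oo X" for j
    by (induction j) (simp_all add: step)
  \<comment> \<open>The iteration has exponent \<open>k - 1\<close>, the Stirling sum needs
    \<open>k\<close>. Dividing by \<open>i\<close> is harmless at \<open>i = 0\<close> because
    \<open>W $ 0 = 0\<close>.\<close>
  have power: "of_nat i ^ (k - 1) * W $ i = of_nat i ^ k * (W $ i / of_nat i)" if "k \<ge> 1" for i k
    using that W0 by (cases k; cases "i = 0") auto
  have "(\<Sum>k=1..n. of_int (stirling1 n k) * ((fps_XD ^^ (k - 1)) W oo X) $ n) =
      (\<Sum>k=1..n. \<Sum>i=0..n. of_int (stirling1 n k) * of_nat i ^ k * (W $ i / of_nat i * (X ^ i) $ n))"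
    by (intro sum.cong refl)
      (simp only: fps_compose_nth fps_mult_fps_XD_shift fps_nth_Abs_fps power sum_distrib_left
        mult.assoc atLeastAtMost_iff)
  also have "\<dots> = (\<Sum>i=0..n. (\<Sum>k=1..n. of_int (stirling1 n k) * of_nat i ^ k) *
      (W $ i / of_nat i * (X ^ i) $ n))"
    by (subst sum.swap) (simp only: sum_distrib_right)
  also have "\<dots> = (\<Sum>i=0..n. (\<Prod>j<n. of_nat i - of_nat j) * (W $ i / of_nat i * (X ^ i) $ n))"
    by (simp only: sum_stirling1_power [OF \<open>n \<ge> 1\<close>])
  \<comment> \<open>For \<open>i < n\<close> the product contains the zero factor
    \<open>j = i\<close>.\<close>
  also have "\<dots> = (\<Sum>i\<in>{n}. (\<Prod>j<n. of_nat i - of_nat j) * (W $ i / of_nat i * (X ^ i) $ n))"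
    by (rule sum.mono_neutral_right) auto
  also have "\<dots> = fact n * (W $ n / of_nat n * (X $ 1) ^ n)"
    using startsby_zero_power_nth_same [OF X0, of n] by (simp add: prod_diff_of_nat)
  also have "\<dots> = poly (nu_quot n) \<alpha> * (c $ 1) ^ n"
    using \<open>n \<ge> 1\<close> poly_nu_quot_eq_nth [OF \<open>n \<ge> 1\<close>, of \<alpha>, symmetric] by (simp add: W_def X1)
  finally show ?thesis
    by (simp only: iter flip: WX)
qed

section \<open>Sums over tuples as iterated operators\<close>

lemma tuples_1: "tuples (Suc 0) s = {[s]}"
  by (auto simp: tuples_def length_Suc_conv)

lemma sum_tuples_Suc:
  "(\<Sum>ms\<in>tuples (Suc k) s. f ms) = (\<Sum>j\<le>s. \<Sum>ms\<in>tuples k (s - j). f (j # ms))"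
proof -
  have "(\<Sum>j\<le>s. \<Sum>ms\<in>tuples k (s - j). f (j # ms)) =
      (\<Sum>(j, ms)\<in>(SIGMA j:{..s}. tuples k (s - j)). f (j # ms))"
    by (rule sum.Sigma) (simp_all add: finite_tuples)
  also have "\<dots> = (\<Sum>ms\<in>tuples (Suc k) s. f ms)"
    by (rule sum.reindex_bij_witness [of _ "\<lambda>ms. (hd ms, tl ms)" "\<lambda>(j, ms). j # ms"])
      (auto simp: tuples_def length_Suc_conv)
  finally show ?thesis
    by simp
qed

lemma fps_XD_nth: "fps_XD f $ n = of_nat n * (f $ n :: 'a::comm_ring_1)"
  by (cases n) (simp_all add: fps_XD_def)

text \<open>Split off the first entry \<open>j\<close>: summing over \<open>j\<close> is convolution
  with \<open>A\<close>, the factor for \<open>i = 0\<close> is \<open>Suc s\<close>, just what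
  \<open>x D\<close> contributes in degree \<open>Suc s\<close>, and the tail is a tuple for
  \<open>s - j\<close>.\<close>

lemma sum_tuples_eq_nth:
  fixes A B :: "'a::field_char_0 fps"
  shows "(\<Sum>ms\<in>tuples (Suc k) s.
      (\<Prod>i<k. of_nat (remain (Suc s) ms i) * A $ (ms ! i)) * B $ (ms ! k)) =
    ((\<lambda>f. fps_XD (A * f)) ^^ k) (fps_X * B) $ Suc s"
proof (induction k arbitrary: s)
  case 0
  show ?case
    by (simp add: tuples_1)
next
  case (Suc k)
  let ?T = "\<lambda>f. fps_XD (A * f)"
  \<comment> \<open>The vanishing constant term removes \<open>j = Suc s\<close> from the
    convolution, an index that the tuple sum lacks.\<close>
  have T0: "(?T ^^ k) (fps_X * B) $ 0 = 0"
    by (cases k) (simp_all add: fps_XD_nth)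
  have "(\<Sum>ms\<in>tuples (Suc (Suc k)) s.
      (\<Prod>i<Suc k. of_nat (remain (Suc s) ms i) * A $ (ms ! i)) * B $ (ms ! Suc k)) =
    (\<Sum>j\<le>s. of_nat (Suc s) * (A $ j * (\<Sum>ms\<in>tuples (Suc k) (s - j).
      (\<Prod>i<k. of_nat (remain (Suc (s - j)) ms i) * A $ (ms ! i)) * B $ (ms ! k))))"
    unfolding sum_tuples_Suc [of _ "Suc k"] sum_distrib_left
    by (intro sum.cong refl)
      (simp add: prod.lessThan_Suc_shift remain_def Suc_diff_le ac_simps
        del: of_nat_Suc prod.lessThan_Suc)
  also have "\<dots> = (\<Sum>j\<le>s. of_nat (Suc s) * (A $ j * (?T ^^ k) (fps_X * B) $ Suc (s - j)))"
    by (simp only: Suc.IH)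
  also have "\<dots> = of_nat (Suc s) * (\<Sum>j\<le>s. A $ j * (?T ^^ k) (fps_X * B) $ (Suc s - j))"
    by (simp add: sum_distrib_left Suc_diff_le)
  also have "\<dots> = of_nat (Suc s) * (A * (?T ^^ k) (fps_X * B)) $ Suc s"
    using T0 by (simp add: fps_mult_nth atLeast0AtMost)
  finally show ?case
    by (simp add: fps_XD_nth)
qed

text \<open>Moves an \<open>x D\<close> from the innermost to the outermost place, where it only
  multiplies a coefficient by its degree. What is iterated becomes \<open>V D\<close> with
  \<open>V = A x\<close>.\<close>

lemma funpow_XD_mult:
  fixes A :: "'a::comm_ring_1 fps"
  shows "((\<lambda>f. fps_XD (A * f)) ^^ k) (fps_XD f) =
    fps_XD (((\<lambda>f. A * fps_X * fps_deriv f) ^^ k) f)"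
  by (induction k) (simp_all add: fps_XD_def mult.assoc)

lemma funpow_mult_deriv_uminus:
  fixes V :: "'a::comm_ring_1 fps"
  shows "((\<lambda>f. V * fps_deriv f) ^^ k) (- f) = - ((\<lambda>f. V * fps_deriv f) ^^ k) f"
  by (induction k) simp_all

lemma remain_last:
  assumes "ms \<in> tuples (Suc k) s"
  shows "remain (Suc s) ms k = Suc (ms ! k)"
proof -
  have "sum_list (take k ms) + ms ! k = s"
    using assms take_Suc_conv_app_nth [of k ms]
    by (metis (mono_tags, lifting) lessI mem_Collect_eq order_refl sum_list.append sum_list.Cons
        sum_list.Nil add.right_neutral take_all tuples_def)
  then show ?thesis
    by (simp add: remain_def)
qed

section \<open>Tuple sums of the multinomial formula\<close>

text \<open>Multiplying by \<open>Suc s\<close> supplies the factor for \<open>i = 0\<close>; the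
  product then covers 0 to \<open>k\<close>, and its last factor \<open>ms ! k + 1\<close> is
  absorbed into the weight of the last entry.\<close>

lemma multinom_summand:
  fixes \<alpha> :: "'a::field_char_0"
  assumes ms: "ms \<in> tuples (Suc k) s"
  shows "of_nat (Suc s) *
      (multinom s ms * (\<Prod>i=1..k. of_nat (remain (Suc s) ms i)) * (1 - \<alpha>) ^ (ms ! k)) =
    fact s * ((\<Prod>i<k. of_nat (remain (Suc s) ms i) * fps_exp 1 $ (ms ! i)) *
      Abs_fps (\<lambda>m. of_nat (Suc m) * (1 - \<alpha>) ^ m / fact m) $ (ms ! k))"
proof -
  let ?r = "\<lambda>i. of_nat (remain (Suc s) ms i) :: 'a"
  have len: "length ms = Suc k"
    using ms by (simp add: tuples_def)
  have "(\<Prod>m\<leftarrow>ms. fact m :: 'a) = (\<Prod>i<Suc k. fact (ms ! i))"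
    by (simp add: prod.list_conv_set_nth len atLeast0LessThan del: prod.lessThan_Suc)
  then have fact: "(\<Prod>m\<leftarrow>ms. fact m :: 'a) = (\<Prod>i<k. fact (ms ! i)) * fact (ms ! k)"
    by simp
  have "of_nat (Suc s) * (\<Prod>i=1..k. ?r i) = ?r 0 * (\<Prod>i<k. ?r (Suc i))"
    by (simp add: remain_def prod.atLeast1_atMost_eq)
  also have "\<dots> = (\<Prod>i<Suc k. ?r i)"
    by (simp only: prod.lessThan_Suc_shift)
  also have "\<dots> = (\<Prod>i<k. ?r i) * of_nat (Suc (ms ! k))"
    by (simp only: prod.lessThan_Suc remain_last [OF ms])
  finally have r: "of_nat (Suc s) * (\<Prod>i=1..k. ?r i) = (\<Prod>i<k. ?r i) * of_nat (Suc (ms ! k))" .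
  have "of_nat (Suc s) * (multinom s ms * (\<Prod>i=1..k. ?r i) * (1 - \<alpha>) ^ (ms ! k)) =
      (of_nat (Suc s) * (\<Prod>i=1..k. ?r i)) * multinom s ms * (1 - \<alpha>) ^ (ms ! k)"
    by (simp only: ac_simps)
  then show ?thesis
    unfolding r by (simp add: multinom_def fact prod.distrib prod_dividef)
qed

lemma sum_tuples_multinom:
  fixes \<alpha> :: "'a::field_char_0"
  assumes "k \<ge> 1"
  shows "(\<Sum>ms\<in>tuples k s. multinom s ms * (\<Prod>i=1..k-1. of_nat (remain (Suc s) ms i)) *
      (1 - \<alpha>) ^ (ms ! (k - 1))) =
    fact s * ((\<lambda>f. fps_exp 1 * fps_X * fps_deriv f) ^^ (k - 1)) (fps_X * fps_exp (1 - \<alpha>)) $ Suc s"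
    (is "?S = _")
proof -
  obtain j where k: "k = Suc j"
    using assms by (cases k) auto
  let ?B = "Abs_fps (\<lambda>m. of_nat (Suc m) * (1 - \<alpha>) ^ m / fact m)"
  \<comment> \<open>Being an image of \<open>x D\<close>, this series admits
    \<open>funpow_XD_mult\<close>, whose outer factor \<open>Suc s\<close> cancels the one
    multiplied in.\<close>
  have B: "fps_X * ?B = fps_XD (fps_X * fps_exp (1 - \<alpha>))"
    by (rule fps_ext) (auto simp: fps_XD_nth split: nat.split)
  have "of_nat (Suc s) * ?S = fact s * (\<Sum>ms\<in>tuples (Suc j) s.
      (\<Prod>i<j. of_nat (remain (Suc s) ms i) * fps_exp 1 $ (ms ! i)) * ?B $ (ms ! j))"
    unfolding k sum_distrib_left diff_Suc_1 by (intro sum.cong refl multinom_summand)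
  also have "\<dots> = fact s * (of_nat (Suc s) *
      ((\<lambda>f. fps_exp 1 * fps_X * fps_deriv f) ^^ j) (fps_X * fps_exp (1 - \<alpha>)) $ Suc s)"
    unfolding sum_tuples_eq_nth B funpow_XD_mult fps_XD_nth ..
  finally have "of_nat (Suc s) * ?S = of_nat (Suc s) * (fact s *
      ((\<lambda>f. fps_exp 1 * fps_X * fps_deriv f) ^^ j) (fps_X * fps_exp (1 - \<alpha>)) $ Suc s)"
    by (simp only: mult.left_commute)
  then show ?thesis
    unfolding mult_left_cancel [OF of_nat_neq_0] by (simp only: k diff_Suc_1)
qed

section \<open>The logarithm and the tuple sums of the binomial formula\<close>

text \<open>The inner series is \<open>ln (1 - s)\<close>; its constant term is the junk value \<open>-1 / 0 = 0\<close>.\<close>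

lemma fps_exp_compose_log_nth:
  fixes a :: "'a::field_char_0"
  shows "(fps_exp a oo Abs_fps (\<lambda>m. - 1 / of_nat m)) $ m = (of_nat m - 1 - a) gchoose m"
proof (induction m)
  case 0
  show ?case by simp
next
  case (Suc m)
  let ?c = "Abs_fps (\<lambda>m. - 1 / of_nat m) :: 'a fps"
  let ?E = "fps_exp a oo ?c"
  have "(1 - fps_X) * fps_deriv ?c = - 1"
    by (rule fps_ext) (auto simp: left_diff_distrib split: nat.split simp del: of_nat_Suc)
  \<comment> \<open>From \<open>c' = -1 / (1 - s)\<close>: a first-order equation, hence a two-term
    recurrence for the coefficients.\<close>
  then have "(1 - fps_X) * fps_deriv ?E = - (fps_const a * ?E)"
    by (simp add: fps_compose_deriv fps_compose_mult_distrib) (metis mult.left_commute mult_minus1_right)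
  then have "((1 - fps_X) * fps_deriv ?E) $ m = (- (fps_const a * ?E)) $ m"
    by simp
  then have "of_nat (Suc m) * ?E $ Suc m - of_nat m * ?E $ m = - a * ?E $ m"
    by (cases m) (simp_all add: algebra_simps)
  \<comment> \<open>The form \<open>m - 1 - a + 1\<close> of the numerator shows that both arguments
    of the binomial coefficient rise by one.\<close>
  then have "?E $ Suc m = (of_nat m - 1 - a + 1) / of_nat (Suc m) * ?E $ m"
    by (simp add: field_simps del: of_nat_Suc)
  also have "\<dots> = (of_nat m - 1 - a + 1) gchoose Suc m"
    by (simp only: Suc.IH gbinomial_factors)
  finally show ?case
    by (simp add: algebra_simps)
qed

text \<open>The weights \<open>1 / (m + 1)\<close> are the coefficients of \<open>A\<close> with
  \<open>A x = -ln (1 - x)\<close>; the last entry carries those of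
  \<open>e^((\<alpha> - 1) c)\<close>.\<close>

lemma sum_tuples_gbinomial:
  fixes \<alpha> :: "'a::field_char_0"
  defines "c \<equiv> Abs_fps (\<lambda>m. - 1 / of_nat m)"
  assumes "k \<ge> 1"
  shows "(\<Sum>ms\<in>tuples (k + 1) s.
      (\<Prod>i=1..k. of_nat (remain (Suc s) ms (i - 1)) / of_nat (ms ! (i - 1) + 1)) *
      ((of_nat (ms ! k) - \<alpha>) gchoose (ms ! k))) =
    of_nat (Suc s) * ((\<lambda>f. - c * fps_deriv f) ^^ (k - 1)) (- c * (fps_exp (\<alpha> - 1) oo c)) $ Suc s"
proof -
  obtain j where k: "k = Suc j"
    using assms by (cases k) auto
  let ?A = "Abs_fps (\<lambda>m. 1 / of_nat (Suc m)) :: 'a fps"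
  let ?E = "fps_exp (\<alpha> - 1) oo c"
  have A: "?A * fps_X = - c"
    by (rule fps_ext) (auto simp: c_def split: nat.split)
  have E: "?E $ m = (of_nat m - \<alpha>) gchoose m" for m
    using fps_exp_compose_log_nth [of "\<alpha> - 1" m] by (simp add: c_def)
  have "(\<Sum>ms\<in>tuples (k + 1) s.
      (\<Prod>i=1..k. of_nat (remain (Suc s) ms (i - 1)) / of_nat (ms ! (i - 1) + 1)) *
      ((of_nat (ms ! k) - \<alpha>) gchoose (ms ! k))) =
    (\<Sum>ms\<in>tuples (Suc k) s.
      (\<Prod>i<k. of_nat (remain (Suc s) ms i) * ?A $ (ms ! i)) * ?E $ (ms ! k))"
    by (simp add: E prod.atLeast1_atMost_eq)
  \<comment> \<open>Peeling off the innermost application yields the \<open>x D\<close> that can be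
    moved outward and leaves the exponent \<open>k - 1\<close>.\<close>
  also have "\<dots> = ((\<lambda>f. fps_XD (?A * f)) ^^ j) (fps_XD (?A * fps_X * ?E)) $ Suc s"
    unfolding sum_tuples_eq_nth k funpow_Suc_right by (simp add: mult.assoc)
  finally show ?thesis
    unfolding funpow_XD_mult fps_XD_nth A k by simp
qed

section \<open>The two substitutions and the case \<open>\<alpha> = 0\<close>\<close>

theorem theorem3p1:
  fixes n :: nat and \<alpha> :: "'a::field_char_0"
  assumes "n \<ge> 1"
  shows
    "(-1) ^ (n - 1) * fact (n - 1) * poly (nu_quot n) \<alpha> =
       (\<Sum>k=1..n. of_int (stirling1 n k) *
         (\<Sum>ms\<in>tuples k (n - 1).
           multinom (n - 1) ms * (\<Prod>i=1..k-1. of_nat (remain n ms i)) * (1 - \<alpha>) ^ (ms ! (k - 1))))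
     \<and>
     (-1) ^ (n - 1) * of_nat n * poly (nu_quot n) \<alpha> =
       (\<Sum>k=1..n. of_int (stirling1 n k) *
         (\<Sum>ms\<in>tuples (k + 1) (n - 1).
           (\<Prod>i=1..k. of_nat (remain n ms (i - 1)) / of_nat (ms ! (i - 1) + 1)) *
           ((of_nat (ms ! k) - \<alpha>) gchoose (ms ! k))))
     \<and>
     (-1) ^ (n - 1) * fact n * fact (n - 1) * (a_coeff n :: 'a) =
       (\<Sum>k=1..n. of_int (stirling1 n k) *
         (\<Sum>ms\<in>tuples k (n - 1).
           multinom (n - 1) ms * (\<Prod>i=1..k-1. of_nat (remain n ms i))))
     \<and>
     (-1) ^ (n - 1) * of_nat n * fact n * (a_coeff n :: 'a) =
       (\<Sum>k=1..n. of_int (stirling1 n k) *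
         (\<Sum>ms\<in>tuples (k + 1) (n - 1).
           (\<Prod>i=1..k. of_nat (remain n ms (i - 1)) / of_nat (ms ! (i - 1) + 1))))"
proof -
  obtain s where n: "n = Suc s"
    using assms by (cases n) auto
  have 1: "(-1) ^ (n - 1) * fact (n - 1) * poly (nu_quot n) \<alpha> =
       (\<Sum>k=1..n. of_int (stirling1 n k) *
         (\<Sum>ms\<in>tuples k (n - 1).
           multinom (n - 1) ms * (\<Prod>i=1..k-1. of_nat (remain n ms i)) * (1 - \<alpha>) ^ (ms ! (k - 1))))"
    for \<alpha> :: 'a
  proof -
    let ?U = "\<lambda>f. fps_exp (1 :: 'a) * fps_X * fps_deriv f"
    let ?c = "- fps_X :: 'a fps"
    have exp: "fps_exp a oo ?c = fps_exp (- a)" for a :: 'a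
      using fps_exp_compose_linear [of a "-1"] by (simp flip: fps_const_neg)
    have "(\<Sum>k=1..n. of_int (stirling1 n k) *
        (?U ^^ (k - 1)) (?c * (fps_exp (\<alpha> - 1) oo ?c)) $ n) =
      poly (nu_quot n) \<alpha> * (?c $ 1) ^ n"
      by (rule sum_stirling1_substituted_XD [OF assms]) (simp_all add: exp)
    \<comment> \<open>The sign is \<open>(-1) ^ n\<close> from \<open>c $ 1 = -1\<close>, times one
      more from the negated starting series.\<close>
    then have "(\<Sum>k=1..n. of_int (stirling1 n k) * (?U ^^ (k - 1)) (fps_X * fps_exp (1 - \<alpha>)) $ n) =
        (-1) ^ s * poly (nu_quot n) \<alpha>"
      by (simp add: exp funpow_mult_deriv_uminus sum_negf n del: sum.cl_ivl_Suc)
    moreover have "(\<Sum>k=1..n. of_int (stirling1 n k) *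
         (\<Sum>ms\<in>tuples k (n - 1).
           multinom (n - 1) ms * (\<Prod>i=1..k-1. of_nat (remain n ms i)) * (1 - \<alpha>) ^ (ms ! (k - 1)))) =
      fact s * (\<Sum>k=1..n. of_int (stirling1 n k) *
        (?U ^^ (k - 1)) (fps_X * fps_exp (1 - \<alpha>)) $ n)"
      unfolding sum_distrib_left [of "fact s"]
    proof (intro sum.cong refl)
      fix k assume "k \<in> {1..n}"
      then show "of_int (stirling1 n k) *
          (\<Sum>ms\<in>tuples k (n - 1). multinom (n - 1) ms *
            (\<Prod>i=1..k-1. of_nat (remain n ms i)) * (1 - \<alpha>) ^ (ms ! (k - 1))) =
        fact s * (of_int (stirling1 n k) * (?U ^^ (k - 1)) (fps_X * fps_exp (1 - \<alpha>)) $ n)"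
        using sum_tuples_multinom [of k s \<alpha>] by (simp add: n)
    qed
    ultimately show ?thesis
      by (simp add: n)
  qed
  have 2: "(-1) ^ (n - 1) * of_nat n * poly (nu_quot n) \<alpha> =
       (\<Sum>k=1..n. of_int (stirling1 n k) *
         (\<Sum>ms\<in>tuples (k + 1) (n - 1).
           (\<Prod>i=1..k. of_nat (remain n ms (i - 1)) / of_nat (ms ! (i - 1) + 1)) *
           ((of_nat (ms ! k) - \<alpha>) gchoose (ms ! k))))"
    for \<alpha> :: 'a
  proof -
    let ?c = "Abs_fps (\<lambda>m. - 1 / of_nat m) :: 'a fps"
    let ?U = "\<lambda>f. - ?c * fps_deriv f"
    \<comment> \<open>The geometric series: \<open>e^(-c) = 1 / (1 - s) = -c'\<close>, so
      \<open>V = -c\<close> satisfies \<open>V c' = c e^(-c)\<close>.\<close>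
    have "(fps_exp (-1) oo ?c) $ m = 1" for m
      using fps_exp_compose_log_nth [of "-1" m] by (simp flip: binomial_gbinomial)
    then have "fps_exp (-1) oo ?c = - fps_deriv ?c"
      by (intro fps_ext) (simp del: of_nat_Suc)
    then have "(\<Sum>k=1..n. of_int (stirling1 n k) *
        (?U ^^ (k - 1)) (?c * (fps_exp (\<alpha> - 1) oo ?c)) $ n) =
      poly (nu_quot n) \<alpha> * (?c $ 1) ^ n"
      by (intro sum_stirling1_substituted_XD [OF assms]) simp_all
    then have "(\<Sum>k=1..n. of_int (stirling1 n k) *
        (?U ^^ (k - 1)) (- ?c * (fps_exp (\<alpha> - 1) oo ?c)) $ n) =
        (-1) ^ s * poly (nu_quot n) \<alpha>"
      unfolding mult_minus_left [of ?c "fps_exp (\<alpha> - 1) oo ?c"] funpow_mult_deriv_uminus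
      by (simp add: sum_negf n del: sum.cl_ivl_Suc)
    moreover have "(\<Sum>k=1..n. of_int (stirling1 n k) *
         (\<Sum>ms\<in>tuples (k + 1) (n - 1).
           (\<Prod>i=1..k. of_nat (remain n ms (i - 1)) / of_nat (ms ! (i - 1) + 1)) *
           ((of_nat (ms ! k) - \<alpha>) gchoose (ms ! k)))) =
      of_nat n * (\<Sum>k=1..n. of_int (stirling1 n k) *
        (?U ^^ (k - 1)) (- ?c * (fps_exp (\<alpha> - 1) oo ?c)) $ n)"
      unfolding sum_distrib_left [of "of_nat n"]
    proof (intro sum.cong refl)
      fix k assume "k \<in> {1..n}"
      then have "k \<ge> 1"
        by simp
      from sum_tuples_gbinomial [OF this, of s \<alpha>]
      show "of_int (stirling1 n k) * (\<Sum>ms\<in>tuples (k + 1) (n - 1).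
           (\<Prod>i=1..k. of_nat (remain n ms (i - 1)) / of_nat (ms ! (i - 1) + 1)) *
           ((of_nat (ms ! k) - \<alpha>) gchoose (ms ! k))) =
        of_nat n * (of_int (stirling1 n k) *
          (?U ^^ (k - 1)) (- ?c * (fps_exp (\<alpha> - 1) oo ?c)) $ n)"
        unfolding n diff_Suc_1 by (simp only: mult.left_commute)
    qed
    ultimately show ?thesis
      by (simp add: ac_simps n)
  qed
  \<comment> \<open>The remaining identities are the first two at \<open>\<alpha> = 0\<close>, where
    \<open>(1 - \<alpha>) ^ m\<close> and \<open>m gchoose m\<close> equal 1.\<close>
  have a: "fact n * a_coeff n = (poly (nu_quot n) 0 :: 'a)"
    by (simp add: a_coeff_altdef [OF assms])
  have 3: "(-1) ^ (n - 1) * fact n * fact (n - 1) * (a_coeff n :: 'a) =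
       (\<Sum>k=1..n. of_int (stirling1 n k) *
         (\<Sum>ms\<in>tuples k (n - 1).
           multinom (n - 1) ms * (\<Prod>i=1..k-1. of_nat (remain n ms i))))"
    using 1 [of 0] by (simp add: ac_simps flip: a)
  have 4: "(-1) ^ (n - 1) * of_nat n * fact n * (a_coeff n :: 'a) =
       (\<Sum>k=1..n. of_int (stirling1 n k) *
         (\<Sum>ms\<in>tuples (k + 1) (n - 1).
           (\<Prod>i=1..k. of_nat (remain n ms (i - 1)) / of_nat (ms ! (i - 1) + 1))))"
    using 2 [of 0] by (simp add: ac_simps flip: a binomial_gbinomial)
  show ?thesis
    using 1 2 3 4 by (intro conjI)
qed

end
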